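(* Let $G$ be a finite group with $|G|\ge 2$. Then $$\operatorname{cp}(G)\ \ge\ \frac{3|G|-2}{|G|^2}.$$ Moreover, if $|G|\ge 3$, then $$\operatorname{cp}(G)\ \ge\ \frac{3}{|G|}.$$
   Context: For a finite group $G$, the commuting probability of $G$ is $\operatorname{cp}(G)=\dfrac{|L(G)|}{|G|^2}$, where $L(G)=\{(x,y)\in G\times G: xy=yx\}$. *)

theory Defs
  imports Complex_Main "HOL-Algebra.Algebra"
begin

definition commuting_pairs :: "('a, 'b) monoid_scheme \<Rightarrow> ('a \<times> 'a) set" where
  "commuting_pairs G =
    {(x, y). x \<in> carrier G \<and> y \<in> carrier G \<and> x \<otimes>\<^bsub>G\<^esub> y = y \<otimes>\<^bsub>G\<^esub> x}"

definition commuting_prob :: "('a, 'b) monoid_scheme \<Rightarrow> real" where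
  "commuting_prob G = real (card (commuting_pairs G)) / (real (order G))\<^sup>2"

end

theory Submission
  imports Defs
begin

text \<open>
  The pairs \<open>(\<one>, x)\<close>, \<open>(x, \<one>)\<close> and \<open>(x, x)\<close> commute in every group. These three families have
  \<open>n = |G|\<close> members each and share only the pair \<open>(\<one>, \<one>)\<close>, so there are at least \<open>3 n - 2\<close>
  commuting pairs, which is the first bound.

  For \<open>3 / n\<close> two more pairs are needed, unless the group is abelian. If some \<open>a\<close> differs from
  its inverse, then \<open>(a, inv a)\<close> and \<open>(inv a, a)\<close> are new, since their entries are distinct and
  neither is \<open>\<one>\<close>. If every element is its own inverse, the group is abelian, so all \<open>n\<^sup>2\<close>
  pairs commute, and \<open>n\<^sup>2 \<ge> 3 n\<close> as soon as \<open>n \<ge> 3\<close>.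
\<close>

definition trivial_commuting_pairs :: "('a, 'b) monoid_scheme \<Rightarrow> ('a \<times> 'a) set" where
  "trivial_commuting_pairs G =
    {\<one>\<^bsub>G\<^esub>} \<times> carrier G \<union> carrier G \<times> {\<one>\<^bsub>G\<^esub>} \<union> (\<lambda>x. (x, x)) ` carrier G"

lemma finite_commuting_pairs:
  assumes "finite (carrier G)"
  shows "finite (commuting_pairs G)"
proof (rule finite_subset)
  show "commuting_pairs G \<subseteq> carrier G \<times> carrier G"
    by (auto simp: commuting_pairs_def)
qed (simp add: assms)

context group
begin

lemma trivial_commuting_pairs_subset: "trivial_commuting_pairs G \<subseteq> commuting_pairs G"
  by (auto simp: trivial_commuting_pairs_def commuting_pairs_def)

lemma card_trivial_commuting_pairs:
  assumes fin: "finite (carrier G)"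
  shows "card (trivial_commuting_pairs G) = 3 * order G - 2"
proof -
  let ?N = "carrier G - {\<one>}"
  \<comment> \<open>Removing the identity from two of the families makes the three of them disjoint.\<close>
  have split: "trivial_commuting_pairs G =
      {\<one>} \<times> carrier G \<union> (?N \<times> {\<one>} \<union> (\<lambda>x. (x, x)) ` ?N)"
    by (auto simp: trivial_commuting_pairs_def)
  have N: "card ?N = order G - 1"
    by (simp add: order_def)
  have diag: "card ((\<lambda>x. (x, x)) ` ?N) = order G - 1"
    unfolding N[symmetric] by (rule card_image) (simp add: inj_on_def)
  have "card (?N \<times> {\<one>} \<union> (\<lambda>x. (x, x)) ` ?N) = (order G - 1) + (order G - 1)"
    using fin N diag by (subst card_Un_disjoint) (auto simp: card_cartesian_product)
  then have "card (trivial_commuting_pairs G) = order G + ((order G - 1) + (order G - 1))"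
    unfolding split using fin
    by (subst card_Un_disjoint) (auto simp: card_cartesian_product order_def)
  moreover have "order G > 0"
    using fin by (simp add: order_gt_0_iff_finite)
  ultimately show ?thesis
    by simp
qed

text \<open>Inversion reverses products, so it can only fix every product if the order is irrelevant.\<close>

lemma commutes_if_all_self_inverse:
  assumes self_inv: "\<And>z. z \<in> carrier G \<Longrightarrow> inv z = z"
    and x: "x \<in> carrier G" and y: "y \<in> carrier G"
  shows "x \<otimes> y = y \<otimes> x"
proof -
  have "x \<otimes> y = inv (x \<otimes> y)"
    using x y by (simp only: self_inv m_closed)
  also have "\<dots> = y \<otimes> x"
    using x y by (simp only: inv_mult_group self_inv)
  finally show ?thesis .
qed

lemma card_commuting_pairs_ge:
  assumes "finite (carrier G)"
  shows "card (commuting_pairs G) \<ge> 3 * order G - 2"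
  using card_mono[OF finite_commuting_pairs trivial_commuting_pairs_subset] assms
  by (simp add: card_trivial_commuting_pairs)

text \<open>
  The two pairs missing from the trivial ones come from an element and its inverse; an elementary
  abelian 2-group has no such element, but there all pairs commute.
\<close>

lemma card_commuting_pairs_ge_three_order:
  assumes fin: "finite (carrier G)" and ord: "order G \<ge> 3"
  shows "card (commuting_pairs G) \<ge> 3 * order G"
proof (cases "\<exists>a \<in> carrier G. inv a \<noteq> a")
  case True
  then obtain a where a: "a \<in> carrier G" "inv a \<noteq> a"
    by blast
  then have ne: "a \<noteq> \<one>" "inv a \<noteq> \<one>"
    by auto
  let ?E = "{(a, inv a), (inv a, a)}"
  have "trivial_commuting_pairs G \<inter> ?E = {}"
    using a ne by (auto simp: trivial_commuting_pairs_def)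
  moreover have "finite (trivial_commuting_pairs G)"
    using fin by (simp add: trivial_commuting_pairs_def)
  ultimately have "card (trivial_commuting_pairs G \<union> ?E) = (3 * order G - 2) + 2"
    using a fin by (subst card_Un_disjoint) (auto simp: card_trivial_commuting_pairs)
  moreover have "trivial_commuting_pairs G \<union> ?E \<subseteq> commuting_pairs G"
    using trivial_commuting_pairs_subset a by (auto simp: commuting_pairs_def)
  ultimately show ?thesis
    using card_mono[OF finite_commuting_pairs[OF fin], of "trivial_commuting_pairs G \<union> ?E"] ord
    by linarith
next
  case False
  then have "commuting_pairs G = carrier G \<times> carrier G"
    using commutes_if_all_self_inverse by (auto simp: commuting_pairs_def)
  then have "card (commuting_pairs G) = order G * order G"
    by (simp add: card_cartesian_product order_def)
  then show ?thesis
    using ord by simp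
qed

end

theorem proposition2:
  fixes G :: "('a, 'b) monoid_scheme"
  assumes "group G" and "finite (carrier G)" and "order G \<ge> 2"
  shows "commuting_prob G \<ge> (3 * real (order G) - 2) / (real (order G))\<^sup>2
    \<and> (order G \<ge> 3 \<longrightarrow> commuting_prob G \<ge> 3 / real (order G))"
proof (intro conjI impI)
  interpret group G by fact
  have "3 * real (order G) - 2 \<le> real (card (commuting_pairs G))"
    using card_commuting_pairs_ge[OF assms(2)] by linarith
  then show "commuting_prob G \<ge> (3 * real (order G) - 2) / (real (order G))\<^sup>2"
    unfolding commuting_prob_def by (intro divide_right_mono) auto
  assume ord: "order G \<ge> 3"
  have "3 / real (order G) = 3 * real (order G) / (real (order G))\<^sup>2"
    using ord by (simp add: power2_eq_square)
  also have "\<dots> \<le> commuting_prob G"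
    unfolding commuting_prob_def
    using card_commuting_pairs_ge_three_order[OF assms(2) ord]
    by (intro divide_right_mono) auto
  finally show "commuting_prob G \<ge> 3 / real (order G)" .
qed

end
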